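(* Let $A\in\mathbb{R}^{n\times n}$, $C\in\mathbb{R}^{p\times n}$, $N\ge1$, $\sigma>0$, with observability matrix $O\in\mathbb{R}^{Np\times n}$ and Gramian $W_o=O^\top O$. Let $L_{\mathcal{M}}=OO^\top$, let $Y'\sim\mathcal{P}^n_{L_{\mathcal{M}}}$ be drawn from the $k$-DPP of $L_{\mathcal{M}}$ with cardinality $n$, and let $W_o(Y)\succ0$ for a sensor configuration $Y\subseteq\mathcal{Y}=\{1,\dots,p\}$. Then $$\mathbb{P}(Y'\subseteq\mathcal{M}_Y)=\frac{\det(\Sigma(\mathcal{Y}))}{\det(\Sigma(Y))},$$ and if $(1-\epsilon)W_o\preceq W_o(Y)$ for some $\epsilon\in[0,1)$, then $$\mathbb{P}(Y'\subseteq\mathcal{M}_Y)\ge(1-\epsilon)^n,\qquad\det(\Sigma(Y))\le\frac{\det(\Sigma(\mathcal{Y}))}{(1-\epsilon)^n}.$$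
   Context: For $x[k+1]=Ax[k]+Bu[k]$, $y[k]=Cx[k]$ with $C\in\mathbb{R}^{p\times n}$, the observability matrix over horizon $N$ is $O=[C^\top,(CA)^\top,\dots,(CA^{N-1})^\top]^\top\in\mathbb{R}^{Np\times n}$ and the observability Gramian is $W_o=\sum_{k=0}^{N-1}(A^k)^\top C^\top CA^k=O^\top O$. For $Y\subseteq\{1,\dots,p\}$, $C_Y$ consists of the rows of $C$ indexed by $Y$, and $W_o(Y)=\sum_{k=0}^{N-1}(A^k)^\top C_Y^\top C_YA^k$, so $W_o(\mathcal{Y})=W_o$. $\mathcal{M}=\{1,\dots,Np\}$ indexes the rows of $O$, and $\mathcal{M}_Y\subseteq\mathcal{M}$ is the set of indices of the rows generated by the sensors in $Y$, i.e. rows $c_i^\top A^k$ with $i\in Y$, $0\le k\le N-1$, where $c_i^\top$ is the $i$-th row of $C$. The $k$-DPP of cardinality $n$ with kernel $L_{\mathcal{M}}=OO^\top$ is the probability measure on subsets $S\subseteq\mathcal{M}$ with $|S|=n$ given by $\mathcal{P}^n_{L_{\mathcal{M}}}(S)=\det((L_{\mathcal{M}})_S)/\sum_{|S'|=n}\det((L_{\mathcal{M}})_{S'})$, where $(\cdot)_S$ denotes the principal submatrix indexed by $S$. $\Sigma(Y):=\sigma^2W_o(Y)^{-1}$; this is the error covariance of the least squares estimate of $x[0]$ from the measurements over the horizon by the sensors in $Y$, under $y[k]=Cx[k]+v[k]$ with zero-mean Gaussian noise of covariance $\sigma^2I$; in particular $\Sigma(\mathcal{Y})=\sigma^2W_o^{-1}$.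 $\preceq$ is the positive semidefinite order. *)

theory Defs
  imports
    "HOL-Probability.Probability_Mass_Function"
    "Jordan_Normal_Form.Determinant"
    "Jordan_Normal_Form.Gauss_Jordan_Elimination"
    "Jordan_Normal_Form.DL_Submatrix"
begin

hide_const (open) Determinants.det Finite_Cartesian_Product.mat

definition psd_mat :: "real mat \<Rightarrow> bool" where
  "psd_mat M \<longleftrightarrow> square_mat M \<and> transpose_mat M = M \<and>
     (\<forall>v \<in> carrier_vec (dim_row M). 0 \<le> scalar_prod v (M *\<^sub>v v))"

definition pd_mat :: "real mat \<Rightarrow> bool" where
  "pd_mat M \<longleftrightarrow> square_mat M \<and> transpose_mat M = M \<and>
     (\<forall>v \<in> carrier_vec (dim_row M). v \<noteq> 0\<^sub>v (dim_row M) \<longrightarrow> 0 < scalar_prod v (M *\<^sub>v v))"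

definition loewner_le :: "real mat \<Rightarrow> real mat \<Rightarrow> bool" where
  "loewner_le P Q \<longleftrightarrow> P \<in> carrier_mat (dim_row Q) (dim_col Q) \<and> psd_mat (Q - P)"

(* Sensors and matrix rows are numbered from 0. With p = dim_row C sensors, row k * p + i of the
   observability matrix is row i of C * A ^ k. *)
definition obs_mat :: "real mat \<Rightarrow> real mat \<Rightarrow> nat \<Rightarrow> real mat" where
  "obs_mat A C N = mat (N * dim_row C) (dim_col C)
     (\<lambda>(r, j). (C * A ^\<^sub>m (r div dim_row C)) $$ (r mod dim_row C, j))"

definition obs_gramian :: "real mat \<Rightarrow> real mat \<Rightarrow> nat \<Rightarrow> real mat" where
  "obs_gramian A C N = transpose_mat (obs_mat A C N) * obs_mat A C N"

definition sensor_rows :: "real mat \<Rightarrow> nat set \<Rightarrow> real mat" where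
  "sensor_rows C Y = submatrix C Y UNIV"

(* The matrix sum over k < N is written entrywise, since the type of matrices has no zero element
   for the generic sum operator. *)
definition sensor_gramian :: "real mat \<Rightarrow> real mat \<Rightarrow> nat \<Rightarrow> nat set \<Rightarrow> real mat" where
  "sensor_gramian A C N Y = mat (dim_col C) (dim_col C) (\<lambda>ij. \<Sum>k<N.
     (transpose_mat (A ^\<^sub>m k) * transpose_mat (sensor_rows C Y) * sensor_rows C Y * A ^\<^sub>m k) $$ ij)"

definition obs_row_set :: "real mat \<Rightarrow> nat \<Rightarrow> nat set \<Rightarrow> nat set" where
  "obs_row_set C N Y = {k * dim_row C + i | k i. k < N \<and> i \<in> Y}"

(* mat_inverse returns None on singular matrices, so this is meaningful only for an invertible
   Gramian. *)
definition error_cov :: "real mat \<Rightarrow> real mat \<Rightarrow> nat \<Rightarrow> real \<Rightarrow> nat set \<Rightarrow> real mat" where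
  "error_cov A C N \<sigma> Y = \<sigma>\<^sup>2 \<cdot>\<^sub>m the (mat_inverse (sensor_gramian A C N Y))"

definition kdpp_weight_sum :: "real mat \<Rightarrow> nat \<Rightarrow> real" where
  "kdpp_weight_sum L k = (\<Sum>S | S \<subseteq> {0..<dim_row L} \<and> card S = k. det (submatrix L S S))"

definition kdpp :: "real mat \<Rightarrow> nat \<Rightarrow> nat set pmf" where
  "kdpp L k = embed_pmf (\<lambda>S. if S \<subseteq> {0..<dim_row L} \<and> card S = k
     then det (submatrix L S S) / kdpp_weight_sum L k else 0)"

(* embed_pmf is unspecified unless its argument is a probability mass function; the assumptions
   below guarantee that it is one. They hold whenever L is positive semidefinite of rank at
   least k. *)
lemma pmf_kdpp:
  assumes nonneg: "\<And>S. S \<subseteq> {0..<dim_row L} \<Longrightarrow> card S = k \<Longrightarrow> 0 \<le> det (submatrix L S S)"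
    and nonzero: "kdpp_weight_sum L k \<noteq> 0"
  shows "pmf (kdpp L k) S = (if S \<subseteq> {0..<dim_row L} \<and> card S = k
     then det (submatrix L S S) / kdpp_weight_sum L k else 0)"
proof -
  let ?F = "{S. S \<subseteq> {0..<dim_row L} \<and> card S = k}"
  let ?f = "\<lambda>S. if S \<subseteq> {0..<dim_row L} \<and> card S = k
     then det (submatrix L S S) / kdpp_weight_sum L k else 0"
  have fin: "finite ?F"
    by (rule finite_subset[of _ "Pow {0..<dim_row L}"]) auto
  have pos: "0 \<le> kdpp_weight_sum L k"
    unfolding kdpp_weight_sum_def by (rule sum_nonneg) (use nonneg in auto)
  have f0: "0 \<le> ?f S" for S
    using nonneg[of S] pos by simp
  have "(\<integral>\<^sup>+S. ennreal (?f S) \<partial>count_space UNIV) = (\<Sum>S\<in>?F. ennreal (?f S))"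
    by (rule nn_integral_count_space'[OF fin]) auto
  also have "\<dots> = ennreal (\<Sum>S\<in>?F. ?f S)"
    by (rule sum_ennreal) (rule f0)
  also have "(\<Sum>S\<in>?F. ?f S) = (\<Sum>S\<in>?F. det (submatrix L S S)) / kdpp_weight_sum L k"
    by (simp add: sum_divide_distrib)
  also have "\<dots> = 1"
    using nonzero by (simp add: kdpp_weight_sum_def)
  finally have "(\<integral>\<^sup>+S. ennreal (?f S) \<partial>count_space UNIV) = 1" by simp
  then show ?thesis
    unfolding kdpp_def by (rule pmf_embed_pmf[OF f0])
qed

end

theory Submission
  imports Defs
begin

text \<open>
  Let \<open>O\<close> be the observability matrix. The principal minor of \<open>O O\<^sup>T\<close> indexed by an \<open>n\<close>-element row
  set \<open>S\<close> is the square of the maximal minor of \<open>O\<close> with rows \<open>S\<close>. By the Cauchy--Binet formula, the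
  sum of these squares over all \<open>S\<close> inside a row set \<open>T\<close> is the determinant of the Gram matrix of the
  rows in \<open>T\<close>. For \<open>T\<close> the rows of the sensors in \<open>Y\<close> this Gram matrix is \<open>W\<^sub>o(Y)\<close>, so the
  probability is \<open>det W\<^sub>o(Y) / det W\<^sub>o\<close>.

  The bounds need monotonicity of the determinant in the Loewner order. If \<open>P\<close> is a Gram matrix and
  \<open>Q - P\<close> is positive semidefinite, factor \<open>Q - P = R\<^sup>T R\<close> by successive Schur complements and append
  the rows of \<open>R\<close> to those of \<open>P\<close>. Then \<open>Q\<close> is a Gram matrix with more rows, and its Cauchy--Binet
  sum of squares contains that of \<open>P\<close>.
\<close>

section \<open>The Cauchy--Binet formula\<close>

text \<open>Multilinearity in the rows: row \<open>i\<close> is the sum over \<open>r\<close> of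
  \<open>A r i\<close> times row \<open>r\<close> of \<open>B\<close>, and \<open>f\<close> records
  which \<open>r\<close> is chosen in each row.\<close>

lemma det_gram_expand:
  fixes A B :: "nat \<Rightarrow> nat \<Rightarrow> 'a :: comm_ring_1"
  assumes T: "finite T"
  shows "det (mat n n (\<lambda>(i, j). \<Sum>r\<in>T. A r i * B r j)) =
    (\<Sum>f\<in>{0..<n} \<rightarrow>\<^sub>E T. (\<Prod>i=0..<n. A (f i) i) * det (mat n n (\<lambda>(i, j). B (f i) j)))"
proof -
  let ?P = "{q. q permutes {0..<n}}"
  have perm: "q i < n" if "q permutes {0..<n}" "i < n" for q i
    using permutes_in_image[OF that(1), of i] that(2) by simp
  have "det (mat n n (\<lambda>(i, j). \<Sum>r\<in>T. A r i * B r j)) =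
      (\<Sum>q\<in>?P. signof q * (\<Prod>i=0..<n. \<Sum>r\<in>T. A r i * B r (q i)))"
    by (subst det_def'[of _ n]) (auto intro!: sum.cong prod.cong simp: perm)
  also have "\<dots> = (\<Sum>q\<in>?P. \<Sum>f\<in>{0..<n} \<rightarrow>\<^sub>E T.
      (\<Prod>i=0..<n. A (f i) i) * (signof q * (\<Prod>i=0..<n. B (f i) (q i))))"
    using T by (subst prod_sum_PiE) (auto simp: sum_distrib_left prod.distrib mult_ac intro!: sum.cong)
  also have "\<dots> = (\<Sum>f\<in>{0..<n} \<rightarrow>\<^sub>E T. (\<Prod>i=0..<n. A (f i) i) *
      (\<Sum>q\<in>?P. signof q * (\<Prod>i=0..<n. B (f i) (q i))))"
    by (subst sum.swap) (simp add: sum_distrib_left)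
  also have "\<dots> = (\<Sum>f\<in>{0..<n} \<rightarrow>\<^sub>E T. (\<Prod>i=0..<n. A (f i) i) * det (mat n n (\<lambda>(i, j). B (f i) j)))"
    by (subst det_def'[of _ n]) (auto intro!: sum.cong prod.cong arg_cong2[where f = "(*)"] simp: perm)
  finally show ?thesis .
qed

lemma bij_betw_pick:
  assumes "finite S" "card S = n"
  shows "bij_betw (pick S) {0..<n} S"
proof -
  have "inj_on (pick S) {0..<n}"
    using assms pick_mono_le[of _ S] by (intro linorder_inj_onI) (auto, metis less_irrefl)
  moreover have "pick S ` {0..<n} \<subseteq> S"
    using assms pick_in_set_le[of _ S] by auto
  ultimately show ?thesis
    using assms by (simp add: bij_betw_def card_image card_subset_eq)
qed

text \<open>Each bijection \<open>f\<close> onto \<open>S\<close> is \<open>h \<circ> q\<close> for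
  exactly one permutation \<open>q\<close>. The \<open>B\<close>-minor with rows ordered by
  \<open>f\<close> is \<open>signof q\<close> times the one ordered by \<open>h\<close>, and what
  remains is the Leibniz sum of the \<open>A\<close>-minor.\<close>

lemma sum_bij_betw_det:
  fixes A B :: "nat \<Rightarrow> nat \<Rightarrow> 'a :: comm_ring_1"
  assumes h: "bij_betw h {0..<n} S"
  shows "(\<Sum>f\<in>{f \<in> {0..<n} \<rightarrow>\<^sub>E S. bij_betw f {0..<n} S}.
      (\<Prod>i=0..<n. A (f i) i) * det (mat n n (\<lambda>(i, j). B (f i) j))) =
    det (mat n n (\<lambda>(i, j). A (h i) j)) * det (mat n n (\<lambda>(i, j). B (h i) j))"
    (is "(\<Sum>f\<in>?F. ?t f) = det ?A * det ?B")
proof -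
  let ?P = "{q. q permutes {0..<n}}"
  let ?g = "inv_into {0..<n} h"
  have perm: "q i < n" if "q permutes {0..<n}" "i < n" for q i
    using permutes_in_image[OF that(1), of i] that(2) by simp
  have hS: "h i \<in> S" "?g (h i) = i" if "i < n" for i
    using h that by (auto simp: bij_betw_def)
  have gS: "?g s < n" "h (?g s) = s" if "s \<in> S" for s
    using h that inv_into_into[of s h "{0..<n}"] by (auto simp: bij_betw_def f_inv_into_f)
  \<comment> \<open>The two index sets follow different conventions outside \<open>{0..<n}\<close>:
    functions in \<open>?F\<close> are \<open>undefined\<close> there, permutations are the
    identity. Both witnesses convert between them.\<close>
  have "(\<Sum>f\<in>?F. ?t f) = (\<Sum>q\<in>?P. (\<Prod>i=0..<n. A (h (q i)) i) * (signof q * det ?B))"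
  proof (rule sum.reindex_bij_witness[where
        j = "\<lambda>f i. if i \<in> {0..<n} then ?g (f i) else i" and i = "\<lambda>q. restrict (h \<circ> q) {0..<n}"])
    fix f assume f: "f \<in> ?F"
    then have fS: "f i \<in> S" if "i < n" for i using that by auto
    show "restrict (h \<circ> (\<lambda>i. if i \<in> {0..<n} then ?g (f i) else i)) {0..<n} = f"
      using f by (intro ext) (auto simp: gS fS restrict_def PiE_def extensional_def)
    have "bij_betw (?g \<circ> f) {0..<n} {0..<n}"
      using f bij_betw_inv_into[OF h] by (auto intro: bij_betw_trans)
    then have "bij_betw (\<lambda>i. if i \<in> {0..<n} then ?g (f i) else i) {0..<n} {0..<n}"
      by (rule bij_betw_cong[THEN iffD1, rotated]) auto
    then have q: "(\<lambda>i. if i \<in> {0..<n} then ?g (f i) else i) permutes {0..<n}"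
      by (rule bij_imp_permutes) auto
    then show "(\<lambda>i. if i \<in> {0..<n} then ?g (f i) else i) \<in> ?P" by simp
    let ?q = "\<lambda>i. if i \<in> {0..<n} then ?g (f i) else i"
    have "det (mat n n (\<lambda>(i, j). B (f i) j)) = det (mat n n (\<lambda>(i, j). ?B $$ (?q i, j)))"
      by (rule arg_cong[of _ _ det], rule eq_matI) (auto simp: gS fS)
    also have "\<dots> = signof ?q * det ?B"
      by (rule det_permute_rows[OF _ q]) simp
    finally show "(\<Prod>i=0..<n. A (h (?q i)) i) * (signof ?q * det ?B) = ?t f"
      by (simp add: gS fS)
  next
    fix q assume "q \<in> ?P"
    then have q: "q permutes {0..<n}" by simp
    show "(\<lambda>i. if i \<in> {0..<n} then ?g (restrict (h \<circ> q) {0..<n} i) else i) = q"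
      using permutes_not_in[OF q] by (intro ext) (auto simp: hS perm[OF q])
    have "bij_betw (h \<circ> q) {0..<n} S"
      using permutes_imp_bij[OF q] h by (rule bij_betw_trans)
    then show "restrict (h \<circ> q) {0..<n} \<in> ?F"
      by (auto simp: hS perm[OF q] bij_betw_restrict_eq)
  qed
  also have "\<dots> = (\<Sum>q\<in>?P. signof q * (\<Prod>i=0..<n. A (h (q i)) i)) * det ?B"
    by (simp add: sum_distrib_left sum_distrib_right mult_ac)
  \<comment> \<open>Here \<open>q\<close> permutes the row index, so this is the Leibniz formula in
    its column form.\<close>
  also have "(\<Sum>q\<in>?P. signof q * (\<Prod>i=0..<n. A (h (q i)) i)) = det ?A"
    by (subst det_col[of _ n]) (auto intro!: sum.cong prod.cong simp: perm atLeast0LessThan)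
  finally show ?thesis .
qed

text \<open>Choice functions that repeat a row contribute nothing. The injective ones are grouped by
  their image \<open>S\<close>, and each group collapses to one product of minors, with the
  increasing enumeration \<open>pick S\<close> as reference ordering.\<close>

lemma Cauchy_Binet:
  fixes A B :: "nat \<Rightarrow> nat \<Rightarrow> 'a :: comm_ring_1"
  assumes T: "finite T"
  shows "det (mat n n (\<lambda>(i, j). \<Sum>r\<in>T. A r i * B r j)) =
    (\<Sum>S | S \<subseteq> T \<and> card S = n.
      det (mat n n (\<lambda>(i, j). A (pick S i) j)) * det (mat n n (\<lambda>(i, j). B (pick S i) j)))"
proof -
  let ?t = "\<lambda>f. (\<Prod>i=0..<n. A (f i) i) * det (mat n n (\<lambda>(i, j). B (f i) j))"
  let ?F = "{f \<in> {0..<n} \<rightarrow>\<^sub>E T. inj_on f {0..<n}}"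
  let ?S = "{S. S \<subseteq> T \<and> card S = n}"
  have zero: "?t f = 0" if "\<not> inj_on f {0..<n}" for f
  proof -
    from that obtain i j where ij: "i < n" "j < n" "i \<noteq> j" "f i = f j"
      by (auto simp: inj_on_def)
    have "det (mat n n (\<lambda>(i, j). B (f i) j)) = 0"
      by (rule det_identical_rows[of _ n i j]) (use ij in \<open>auto intro!: eq_vecI\<close>)
    then show ?thesis by simp
  qed
  have "det (mat n n (\<lambda>(i, j). \<Sum>r\<in>T. A r i * B r j)) = (\<Sum>f\<in>?F. ?t f)"
    unfolding det_gram_expand[OF T]
    by (rule sum.mono_neutral_right) (use T zero in \<open>auto intro!: finite_PiE\<close>)
  also have "\<dots> = (\<Sum>S\<in>?S. \<Sum>f\<in>{f \<in> ?F. f ` {0..<n} = S}. ?t f)"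
    by (rule sum.group[symmetric])
      (use T in \<open>auto intro!: finite_PiE finite_subset[of _ "Pow T"] simp: card_image\<close>)
  also have "\<dots> = (\<Sum>S\<in>?S. det (mat n n (\<lambda>(i, j). A (pick S i) j)) *
      det (mat n n (\<lambda>(i, j). B (pick S i) j)))"
  proof (rule sum.cong)
    fix S assume S: "S \<in> ?S"
    have "{f \<in> ?F. f ` {0..<n} = S} = {f \<in> {0..<n} \<rightarrow>\<^sub>E S. bij_betw f {0..<n} S}"
      using S by (auto simp: bij_betw_def PiE_iff)
    then show "(\<Sum>f\<in>{f \<in> ?F. f ` {0..<n} = S}. ?t f) =
        det (mat n n (\<lambda>(i, j). A (pick S i) j)) * det (mat n n (\<lambda>(i, j). B (pick S i) j))"
      using sum_bij_betw_det[OF bij_betw_pick[of S n]] S finite_subset[OF _ T] by simp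
  qed simp
  finally show ?thesis .
qed

section \<open>Gram matrices\<close>

text \<open>A nonnegative quadratic polynomial in \<open>t\<close> is tested at one well-chosen
  point. Since division by zero yields zero, the second claim at \<open>a = 0\<close> just says that
  \<open>c\<close> is nonnegative.\<close>

lemma quadratic_nonneg_discriminant:
  fixes a b c :: real
  assumes nonneg: "\<And>t. 0 \<le> c + 2 * t * b + t\<^sup>2 * a" and "0 \<le> a"
  shows "a = 0 \<Longrightarrow> b = 0" and "b\<^sup>2 / a \<le> c"
proof -
  \<comment> \<open>If \<open>b\<close> were nonzero, the polynomial would take the value
    \<open>-1\<close> at this \<open>t\<close>.\<close>
  show zero: "b = 0" if "a = 0"
    using nonneg[of "- (c + 1) / (2 * b)"] that by (cases "b = 0") (auto simp: field_simps)
  show "b\<^sup>2 / a \<le> c"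
  proof (cases "a = 0")
    case True
    then show ?thesis using nonneg[of 0] by simp
  next
    case False
    \<comment> \<open>The minimiser is \<open>- b / a\<close>.\<close>
    then have "c + 2 * (- b / a) * b + (- b / a)\<^sup>2 * a = c - b\<^sup>2 / a"
      by (simp add: field_simps power2_eq_square)
    then show ?thesis using nonneg[of "- b / a"] by simp
  qed
qed

text \<open>A Cholesky-type factorisation that splits off the last index and tolerates a zero pivot.
  With entries given by a function, the induction passes to smaller \<open>n\<close> without cutting
  matrices.\<close>

lemma psd_gram_decomposition:
  fixes D :: "nat \<Rightarrow> nat \<Rightarrow> real"
  assumes "\<And>i j. i < n \<Longrightarrow> j < n \<Longrightarrow> D i j = D j i"
    and "\<And>x. 0 \<le> (\<Sum>i<n. \<Sum>j<n. x i * D i j * x j)"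
  obtains R :: "nat \<Rightarrow> nat \<Rightarrow> real"
  where "\<And>i j. i < n \<Longrightarrow> j < n \<Longrightarrow> D i j = (\<Sum>k<n. R k i * R k j)"
  using assms
proof (induction n arbitrary: D thesis)
  case 0
  then show ?case by auto
next
  case (Suc n)
  define a where "a = D n n"
  define q where "q x = (\<Sum>i<n. \<Sum>j<n. x i * D i j * x j)" for x
  define l where "l x = (\<Sum>i<n. x i * D i n)" for x
  have sym: "D n i = D i n" if "i < n" for i
    using Suc.prems(2)[of n i] that by simp
  \<comment> \<open>Setting the last coordinate to \<open>t\<close> turns the quadratic form into a
    quadratic polynomial in \<open>t\<close>.\<close>
  have quad: "0 \<le> q x + 2 * t * l x + t\<^sup>2 * a" for x t
  proof -
    have "(\<Sum>i<Suc n. \<Sum>j<Suc n. (x(n := t)) i * D i j * (x(n := t)) j) =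
        q x + (\<Sum>i<n. x i * D i n * t) + ((\<Sum>j<n. t * D n j * x j) + t * D n n * t)"
      by (simp add: q_def sum.distrib)
    also have "(\<Sum>i<n. x i * D i n * t) = t * l x"
      by (simp add: l_def sum_distrib_left mult_ac)
    also have "(\<Sum>j<n. t * D n j * x j) = t * l x"
      by (simp add: l_def sum_distrib_left sym mult_ac)
    finally show ?thesis
      using Suc.prems(3)[of "x(n := t)"] by (simp add: a_def power2_eq_square algebra_simps)
  qed
  have a0: "0 \<le> a"
    using quad[of "\<lambda>_. 0" 1] by (simp add: q_def l_def)
  note disc = quadratic_nonneg_discriminant[OF quad a0]
  \<comment> \<open>At the \<open>i\<close>-th unit vector, \<open>l\<close> takes the value
    \<open>D i n\<close>.\<close>
  have col0: "D i n = 0" if "i < n" "a = 0" for i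
    using disc(1)[OF that(2), of "\<lambda>j. if j = i then 1 else 0"] that(1)
    by (simp add: l_def if_distrib[of "\<lambda>u. u * _"] cong: if_cong)
  \<comment> \<open>The Schur complement of \<open>a\<close>. If \<open>a = 0\<close>, the last column vanishes and \<open>x / 0 = 0\<close> gives \<open>D' = D\<close>.\<close>
  define D' where "D' i j = D i j - D i n * D j n / a" for i j
  have "0 \<le> (\<Sum>i<n. \<Sum>j<n. x i * D' i j * x j)" for x
  proof -
    have "(l x)\<^sup>2 / a = (\<Sum>i<n. \<Sum>j<n. x i * (D i n * D j n / a) * x j)"
      by (simp add: l_def power2_eq_square sum_product sum_divide_distrib mult_ac)
    then have "(\<Sum>i<n. \<Sum>j<n. x i * D' i j * x j) = q x - (l x)\<^sup>2 / a"
      by (simp add: D'_def q_def algebra_simps sum_subtractf)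
    then show ?thesis using disc(2)[of x] by simp
  qed
  moreover have "D' i j = D' j i" if "i < n" "j < n" for i j
    using Suc.prems(2)[of i j] that by (simp add: D'_def)
  ultimately obtain R where R: "\<And>i j. i < n \<Longrightarrow> j < n \<Longrightarrow> D' i j = (\<Sum>k<n. R k i * R k j)"
    using Suc.IH[of D'] by blast
  \<comment> \<open>The new row \<open>n\<close> restores the term subtracted in \<open>D'\<close>.
    The old rows get a zero in column \<open>n\<close>, so the last column of \<open>D\<close> comes
    from the new row alone.\<close>
  define R' where "R' k i = (if k = n then D i n / sqrt a else if i = n then 0 else R k i)" for k i
  \<comment> \<open>The factor \<open>a / sqrt a\<close> is the entry of the new row in column
    \<open>n\<close>. For \<open>a = 0\<close> both sides vanish by \<open>col0\<close>.\<close>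
  have D_last: "D i n = D i n / sqrt a * (a / sqrt a)" if "i \<le> n" for i
    using a0 that col0[of i] by (cases "i = n") (auto simp: a_def real_div_sqrt)
  have "D i j = (\<Sum>k<Suc n. R' k i * R' k j)" if ij: "i < Suc n" "j < Suc n" for i j
  proof (cases "i = n \<or> j = n")
    case True
    then have "D i j = D i n / sqrt a * (D j n / sqrt a)"
      using D_last[of i] D_last[of j] sym[of j] ij by (auto simp: a_def less_Suc_eq mult.commute)
    then show ?thesis using True by (auto simp: R'_def)
  next
    case False
    then have "i < n" "j < n" using ij by auto
    then show ?thesis
      using R[of i j] a0 by (simp add: R'_def D'_def)
  qed
  then show ?case by (rule Suc.prems(1))
qed

text \<open>This is the product of the transpose of \<open>M\<close> with \<open>M\<close>,
  restricted to the rows in \<open>T\<close>. As \<open>M\<close> is a function, choosing a subset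
  of rows needs no renumbering.\<close>

definition gram_rows :: "nat \<Rightarrow> (nat \<Rightarrow> nat \<Rightarrow> 'a) \<Rightarrow> nat set \<Rightarrow> 'a :: comm_ring_1 mat" where
  "gram_rows n M T = mat n n (\<lambda>(i, j). \<Sum>r\<in>T. M r i * M r j)"

lemma gram_rows_carrier [simp]: "gram_rows n M T \<in> carrier_mat n n"
  by (simp add: gram_rows_def)

lemma det_gram_rows:
  "finite T \<Longrightarrow> det (gram_rows n M T) =
    (\<Sum>S | S \<subseteq> T \<and> card S = n. (det (mat n n (\<lambda>(i, j). M (pick S i) j)))\<^sup>2)"
  by (simp add: gram_rows_def Cauchy_Binet power2_eq_square)

lemma det_gram_rows_nonneg:
  fixes M :: "nat \<Rightarrow> nat \<Rightarrow> real"
  shows "finite T \<Longrightarrow> 0 \<le> det (gram_rows n M T)"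
  by (simp add: det_gram_rows sum_nonneg)

text \<open>Enlarging the row set only adds squares to the Cauchy-Binet sum.\<close>

lemma det_gram_rows_mono:
  fixes M :: "nat \<Rightarrow> nat \<Rightarrow> real"
  assumes "finite U" "T \<subseteq> U"
  shows "det (gram_rows n M T) \<le> det (gram_rows n M U)"
  using assms by (subst (1 2) det_gram_rows)
    (auto intro!: sum_mono2 finite_subset[of _ "Pow U"] dest: finite_subset)

lemma psd_mat_gram_rows:
  assumes "psd_mat D" "D \<in> carrier_mat n n"
  obtains R where "D = gram_rows n R {..<n}"
proof -
  have sym: "D $$ (i, j) = D $$ (j, i)" if "i < n" "j < n" for i j
  proof -
    have "D = transpose_mat D" using assms(1) by (simp add: psd_mat_def)
    then have "D $$ (i, j) = transpose_mat D $$ (i, j)" by simp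
    then show ?thesis using that assms(2) by simp
  qed
  have psd: "0 \<le> (\<Sum>i<n. \<Sum>j<n. x i * D $$ (i, j) * x j)" for x :: "nat \<Rightarrow> real"
  proof -
    have "0 \<le> scalar_prod (vec n x) (D *\<^sub>v vec n x)"
      using assms by (auto simp: psd_mat_def)
    also have "\<dots> = (\<Sum>i<n. \<Sum>j<n. x i * D $$ (i, j) * x j)"
      using assms(2) by (auto simp: scalar_prod_def atLeast0LessThan sum_distrib_left mult_ac
          intro!: sum.cong)
    finally show ?thesis .
  qed
  obtain R where R: "\<And>i j. i < n \<Longrightarrow> j < n \<Longrightarrow> D $$ (i, j) = (\<Sum>k<n. R k i * R k j)"
    using psd_gram_decomposition[of n "\<lambda>i j. D $$ (i, j)"] sym psd by blast
  show ?thesis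
    by (rule that[of R], rule eq_matI) (use assms(2) R in \<open>auto simp: gram_rows_def\<close>)
qed

lemma det_gram_rows_le_loewner:
  fixes M :: "nat \<Rightarrow> nat \<Rightarrow> real"
  assumes Q: "Q \<in> carrier_mat n n" and psd: "loewner_le (gram_rows n M {..<m}) Q"
  shows "det (gram_rows n M {..<m}) \<le> det Q"
proof -
  let ?P = "gram_rows n M {..<m}"
  have D: "Q - ?P \<in> carrier_mat n n" using Q by (intro minus_carrier_mat) simp
  obtain R where R: "Q - ?P = gram_rows n R {..<n}"
    using psd_mat_gram_rows[OF _ D] psd by (auto simp: loewner_le_def)
  \<comment> \<open>Stacking \<open>R\<close> below the first \<open>m\<close> rows of
    \<open>M\<close> lets both Gram matrices share one row function and differ only in the row
    set.\<close>
  define M' where "M' r = (if r < m then M r else R (r - m))" for r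
  have P: "?P = gram_rows n M' {..<m}"
    by (simp add: gram_rows_def M'_def)
  have "Q = gram_rows n M' {..<m + n}"
  proof (rule eq_matI)
    fix i j assume "i < dim_row (gram_rows n M' {..<m + n})" "j < dim_col (gram_rows n M' {..<m + n})"
    then have ij: "i < n" "j < n" by (auto simp: gram_rows_def)
    have "Q $$ (i, j) = ?P $$ (i, j) + (Q - ?P) $$ (i, j)"
      using ij Q by (simp add: gram_rows_def)
    also have "\<dots> = (\<Sum>r<m. M' r i * M' r j) + (\<Sum>r=m..<m + n. M' r i * M' r j)"
      unfolding R using ij sum.shift_bounds_nat_ivl[of "\<lambda>r. M' r i * M' r j" 0 m n]
      by (simp add: gram_rows_def M'_def atLeast0LessThan add.commute)
    also have "\<dots> = (\<Sum>r<m + n. M' r i * M' r j)"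
      using sum.atLeastLessThan_concat[of 0 m "m + n" "\<lambda>r. M' r i * M' r j"]
      by (simp add: atLeast0LessThan)
    finally show "Q $$ (i, j) = gram_rows n M' {..<m + n} $$ (i, j)"
      using ij by (simp add: gram_rows_def)
  qed (use Q in \<open>auto simp: gram_rows_def\<close>)
  then show ?thesis
    using det_gram_rows_mono[of "{..<m + n}" "{..<m}" n M'] P by simp
qed

text \<open>This keeps a scaled Gramian within the Gram matrices, so that determinant monotonicity
  applies to it.\<close>

lemma smult_gram_rows:
  fixes M :: "nat \<Rightarrow> nat \<Rightarrow> real"
  assumes "0 \<le> c"
  shows "c \<cdot>\<^sub>m gram_rows n M T = gram_rows n (\<lambda>r i. sqrt c * M r i) T"
proof -
  have eq: "sqrt c * x * (sqrt c * y) = c * (x * y)" for x y :: real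
    using real_sqrt_mult_self[of c] assms by (simp add: mult_ac flip: mult.assoc[of "sqrt c" "sqrt c"])
  show ?thesis
    by (intro eq_matI) (auto simp: gram_rows_def sum_distrib_left eq)
qed

text \<open>Since \<open>S\<close> has exactly \<open>n\<close> elements, the selected rows form a
  square matrix \<open>?B\<close>, and the principal submatrix is \<open>?B\<close> times its
  transpose.\<close>

lemma det_submatrix_mult_transpose:
  assumes M: "M \<in> carrier_mat m n" and S: "S \<subseteq> {0..<m}" "card S = n"
  shows "det (submatrix (M * transpose_mat M) S S) =
    (det (mat n n (\<lambda>(i, j). M $$ (pick S i, j))))\<^sup>2"
proof -
  let ?B = "mat n n (\<lambda>(i, j). M $$ (pick S i, j))"
  have eq: "{i. i < m \<and> i \<in> S} = S" using S by auto
  have pick: "pick S i < m" if "i < n" for i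
    using pick_in_set_le[of i S] S that by auto
  have "submatrix (M * transpose_mat M) S S = ?B * transpose_mat ?B"
    by (rule eq_matI) (use M S(2) pick in \<open>auto simp: submatrix_def eq scalar_prod_def\<close>)
  then show ?thesis
    by (simp add: det_mult[of _ n] det_transpose[of _ n] power2_eq_square)
qed

section \<open>Subset probabilities of determinantal point processes\<close>

lemma prob_kdpp_subset:
  fixes M :: "real mat"
  assumes M: "M \<in> carrier_mat m n" and T: "T \<subseteq> {0..<m}"
    and nz: "det (gram_rows n (\<lambda>r i. M $$ (r, i)) {0..<m}) \<noteq> 0"
  shows "measure_pmf.prob (kdpp (M * transpose_mat M) n) {S. S \<subseteq> T} =
    det (gram_rows n (\<lambda>r i. M $$ (r, i)) T) / det (gram_rows n (\<lambda>r i. M $$ (r, i)) {0..<m})"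
proof -
  let ?L = "M * transpose_mat M"
  let ?d = "\<lambda>S. (det (mat n n (\<lambda>(i, j). M $$ (pick S i, j))))\<^sup>2"
  let ?W = "det (gram_rows n (\<lambda>r i. M $$ (r, i)) {0..<m})"
  note minor = det_submatrix_mult_transpose[OF M]
  have dim: "dim_row ?L = m" using M by simp
  have W: "kdpp_weight_sum ?L n = ?W"
    unfolding kdpp_weight_sum_def dim det_gram_rows[OF finite_atLeastLessThan]
    by (rule sum.cong) (auto simp: minor)
  \<comment> \<open>The weights are squares with nonzero sum, which is what \<open>pmf_kdpp\<close>
    requires.\<close>
  have pmf: "pmf (kdpp ?L n) S = (if S \<subseteq> {0..<m} \<and> card S = n then ?d S / ?W else 0)" for S
    by (subst pmf_kdpp; unfold dim W) (use nz in \<open>auto simp: minor\<close>)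
  have fin: "finite T" using T by (rule finite_subset) simp
  have "measure_pmf.prob (kdpp ?L n) {S. S \<subseteq> T} = (\<Sum>S | S \<subseteq> T. pmf (kdpp ?L n) S)"
    using fin by (intro measure_measure_pmf_finite) simp
  also have "\<dots> = (\<Sum>S | S \<subseteq> T. if card S = n then ?d S / ?W else 0)"
    using T by (intro sum.cong refl) (auto simp: pmf)
  also have "\<dots> = (\<Sum>S | S \<subseteq> T \<and> card S = n. ?d S / ?W)"
    using fin by (intro sum.mono_neutral_cong_right) auto
  also have "\<dots> = det (gram_rows n (\<lambda>r i. M $$ (r, i)) T) / ?W"
    by (simp add: det_gram_rows[OF fin] sum_divide_distrib)
  finally show ?thesis .
qed

section \<open>Determinants of positive definite and inverse matrices\<close>

lemma det_pd_mat_nonzero: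
  assumes "pd_mat W" "W \<in> carrier_mat n n"
  shows "det W \<noteq> 0"
proof
  assume "det W = 0"
  then obtain v where "v \<in> carrier_vec n" "v \<noteq> 0\<^sub>v n" "W *\<^sub>v v = 0\<^sub>v n"
    using det_0_iff_vec_prod_zero[OF assms(2)] by blast
  then show False
    using assms by (force simp: pd_mat_def)
qed

lemma det_the_mat_inverse:
  fixes W :: "'a :: field mat"
  assumes W: "W \<in> carrier_mat n n" and nz: "det W \<noteq> 0"
  shows "the (mat_inverse W) \<in> carrier_mat n n" and "det (the (mat_inverse W)) = 1 / det W"
proof -
  have "mat_inverse W \<noteq> None"
    using mat_inverse(1)[OF W, of n] det_non_zero_imp_unit[OF W nz, of n] by blast
  then have V: "W * the (mat_inverse W) = 1\<^sub>m n" "the (mat_inverse W) \<in> carrier_mat n n"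
    using mat_inverse(2)[OF W, of "the (mat_inverse W)"] by auto
  then show "the (mat_inverse W) \<in> carrier_mat n n" by simp
  have "det W * det (the (mat_inverse W)) = 1"
    using V by (simp flip: det_mult[OF W V(2)])
  then show "det (the (mat_inverse W)) = 1 / det W"
    using nz by (simp add: field_simps)
qed

section \<open>Observability Gramians\<close>

text \<open>The rows of \<open>sensor_rows C Y * P\<close> are the rows of \<open>C * P\<close>
  indexed by \<open>Y\<close>, listed by \<open>pick Y\<close>. With \<open>P\<close> a power of
  \<open>A\<close> this is one summand of the sensor Gramian.\<close>

lemma gram_sensor_rows:
  assumes C: "C \<in> carrier_mat p n" and P: "P \<in> carrier_mat n n" and Y: "Y \<subseteq> {0..<p}"
    and ij: "i < n" "j < n"
  shows "(transpose_mat P * transpose_mat (sensor_rows C Y) * sensor_rows C Y * P) $$ (i, j) =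
    (\<Sum>l\<in>Y. (C * P) $$ (l, i) * (C * P) $$ (l, j))"
proof -
  have fin: "finite Y" using Y by (rule finite_subset) simp
  have eq: "{i. i < p \<and> i \<in> Y} = Y" using Y by auto
  define S where "S = sensor_rows C Y"
  have S: "S \<in> carrier_mat (card Y) n"
    using C by (simp add: S_def sensor_rows_def submatrix_def eq)
  have pick: "pick Y l < p" if "l < card Y" for l
    using pick_in_set_le[of l Y] Y that by auto
  have SP: "S * P \<in> carrier_mat (card Y) n" using S P by simp
  have index: "(S * P) $$ (l, j) = (C * P) $$ (pick Y l, j)" if "l < card Y" "j < n" for l j
  proof -
    have "row S l = row C (pick Y l)"
      using that C pick[of l]
      by (intro eq_vecI) (auto simp: S_def sensor_rows_def submatrix_def eq pick_UNIV)
    then show ?thesis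
      using that pick[of l] carrier_matD[OF S] carrier_matD[OF C] carrier_matD[OF P]
      by (subst (1 2) index_mult_mat(1)) auto
  qed
  have "transpose_mat P * transpose_mat S * S * P = transpose_mat P * transpose_mat S * (S * P)"
    by (rule assoc_mult_mat) (use S P in auto)
  also have "\<dots> = transpose_mat (S * P) * (S * P)"
    by (simp only: transpose_mult[OF S P])
  finally have "(transpose_mat P * transpose_mat S * S * P) $$ (i, j) =
      scalar_prod (col (S * P) i) (col (S * P) j)"
    using ij carrier_matD[OF SP] by (simp only:) (subst index_mult_mat(1), auto)
  also have "\<dots> = (\<Sum>l=0..<card Y. (S * P) $$ (l, i) * (S * P) $$ (l, j))"
    using ij carrier_matD[OF SP] by (auto simp: scalar_prod_def simp del: index_mult_mat(1))
  also have "\<dots> = (\<Sum>l=0..<card Y. (C * P) $$ (pick Y l, i) * (C * P) $$ (pick Y l, j))"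
    by (rule sum.cong) (use ij in \<open>simp_all add: index del: index_mult_mat\<close>)
  also have "\<dots> = (\<Sum>l\<in>Y. (C * P) $$ (l, i) * (C * P) $$ (l, j))"
    by (rule sum.reindex_bij_betw[OF bij_betw_pick[OF fin refl]])
  finally show ?thesis by (simp only: S_def)
qed

lemma row_index_less:
  fixes k i p N :: nat
  assumes "k < N" "i < p"
  shows "k * p + i < N * p"
proof -
  have "k * p + i < Suc k * p" using assms(2) by simp
  also have "\<dots> \<le> N * p" using assms(1) by (intro mult_le_mono1) simp
  finally show ?thesis .
qed

context
  fixes A C :: "real mat" and n p N :: nat
  assumes A: "A \<in> carrier_mat n n" and C: "C \<in> carrier_mat p n"
begin

lemma obs_mat_carrier: "obs_mat A C N \<in> carrier_mat (N * p) n"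
  using C by (simp add: obs_mat_def)

lemma obs_gramian_eq_gram_rows:
  "obs_gramian A C N = gram_rows n (\<lambda>r i. obs_mat A C N $$ (r, i)) {0..<N * p}"
  by (rule eq_matI)
    (use obs_mat_carrier in \<open>auto simp: obs_gramian_def gram_rows_def scalar_prod_def\<close>)

lemma obs_mat_index:
  assumes "k < N" "i < p" "j < n"
  shows "obs_mat A C N $$ (k * p + i, j) = (C * A ^\<^sub>m k) $$ (i, j)"
  using C assms row_index_less[OF assms(1,2)] by (simp add: obs_mat_def)

lemma obs_row_set_subset: "Y \<subseteq> {0..<p} \<Longrightarrow> obs_row_set C N Y \<subseteq> {0..<N * p}"
  using C by (auto simp: obs_row_set_def subset_iff intro: row_index_less)

lemma obs_row_set_all: "obs_row_set C N {0..<p} = {0..<N * p}"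
proof
  show "{0..<N * p} \<subseteq> obs_row_set C N {0..<p}"
  proof
    fix r assume "r \<in> {0..<N * p}"
    then have r: "r < N * p" by simp
    \<comment> \<open>For \<open>p = 0\<close> there are no rows, so \<open>r < N * p\<close> is
      contradictory.\<close>
    then have "r div p < N" "r mod p \<in> {0..<p}"
      by (cases "p = 0"; simp add: less_mult_imp_div_less)+
    moreover have "r = r div p * dim_row C + r mod p" using C by simp
    ultimately show "r \<in> obs_row_set C N {0..<p}"
      unfolding obs_row_set_def by blast
  qed
qed (rule obs_row_set_subset, simp)

text \<open>As \<open>i < p\<close>, division with remainder by \<open>p\<close> recovers the time
  \<open>k\<close> and the sensor \<open>i\<close> from the row index.\<close>

lemma sum_obs_row_set:
  assumes Y: "Y \<subseteq> {0..<p}"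
  shows "(\<Sum>r\<in>obs_row_set C N Y. f r) = (\<Sum>k<N. \<Sum>i\<in>Y. f (k * p + i))"
proof -
  have "(\<Sum>r\<in>obs_row_set C N Y. f r) = (\<Sum>(k, i)\<in>{..<N} \<times> Y. f (k * p + i))"
    using C Y by (intro sum.reindex_bij_witness[where j = "\<lambda>r. (r div p, r mod p)"
          and i = "\<lambda>(k, i). k * p + i"]) (auto simp: obs_row_set_def subset_iff)
  also have "\<dots> = (\<Sum>k<N. \<Sum>i\<in>Y. f (k * p + i))"
    using Y by (intro sum.cartesian_product[symmetric])
  finally show ?thesis .
qed

lemma sensor_gramian_eq_gram_rows:
  assumes Y: "Y \<subseteq> {0..<p}"
  shows "sensor_gramian A C N Y =
    gram_rows n (\<lambda>r i. obs_mat A C N $$ (r, i)) (obs_row_set C N Y)"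
proof (rule eq_matI)
  fix i j
  assume "i < dim_row (gram_rows n (\<lambda>r i. obs_mat A C N $$ (r, i)) (obs_row_set C N Y))"
    and "j < dim_col (gram_rows n (\<lambda>r i. obs_mat A C N $$ (r, i)) (obs_row_set C N Y))"
  then have ij: "i < n" "j < n" by (auto simp: gram_rows_def)
  have "sensor_gramian A C N Y $$ (i, j) =
      (\<Sum>k<N. \<Sum>l\<in>Y. (C * A ^\<^sub>m k) $$ (l, i) * (C * A ^\<^sub>m k) $$ (l, j))"
    using ij C by (simp add: sensor_gramian_def gram_sensor_rows[OF C pow_carrier_mat[OF A] Y]
        del: index_mult_mat)
  also have "\<dots> = (\<Sum>r\<in>obs_row_set C N Y. obs_mat A C N $$ (r, i) * obs_mat A C N $$ (r, j))"
    unfolding sum_obs_row_set[OF Y]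
    by (intro sum.cong refl) (use Y ij in \<open>auto simp: obs_mat_index subset_iff simp del: index_mult_mat\<close>)
  finally show "sensor_gramian A C N Y $$ (i, j) =
      gram_rows n (\<lambda>r i. obs_mat A C N $$ (r, i)) (obs_row_set C N Y) $$ (i, j)"
    using ij by (simp add: gram_rows_def)
qed (use C in \<open>auto simp: sensor_gramian_def gram_rows_def\<close>)

text \<open>The scalar factor enters the determinant once for each of the \<open>n\<close>
  dimensions.\<close>

lemma det_error_cov:
  assumes "Y \<subseteq> {0..<p}" "det (sensor_gramian A C N Y) \<noteq> 0"
  shows "det (error_cov A C N \<sigma> Y) = (\<sigma>\<^sup>2) ^ n / det (sensor_gramian A C N Y)"
proof -
  have "sensor_gramian A C N Y \<in> carrier_mat n n"
    using C by (simp add: sensor_gramian_def)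
  from det_the_mat_inverse[OF this assms(2)] show ?thesis
    by (simp add: error_cov_def)
qed

end

theorem corollary5:
  fixes A C :: "real mat" and n p N :: nat and \<sigma> :: real and Y :: "nat set"
  assumes "A \<in> carrier_mat n n" and "C \<in> carrier_mat p n"
    and "N \<ge> 1" and "\<sigma> > 0"
    and "Y \<subseteq> {0..<p}"
    and "pd_mat (sensor_gramian A C N Y)"
  defines "L \<equiv> obs_mat A C N * transpose_mat (obs_mat A C N)"
  shows "measure_pmf.prob (kdpp L n) {Y'. Y' \<subseteq> obs_row_set C N Y}
           = det (error_cov A C N \<sigma> {0..<p}) / det (error_cov A C N \<sigma> Y)
       \<and> (\<forall>\<epsilon>::real. 0 \<le> \<epsilon> \<and> \<epsilon> < 1
            \<and> loewner_le ((1 - \<epsilon>) \<cdot>\<^sub>m obs_gramian A C N) (sensor_gramian A C N Y)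
            \<longrightarrow> measure_pmf.prob (kdpp L n) {Y'. Y' \<subseteq> obs_row_set C N Y} \<ge> (1 - \<epsilon>) ^ n
              \<and> det (error_cov A C N \<sigma> Y) \<le> det (error_cov A C N \<sigma> {0..<p}) / (1 - \<epsilon>) ^ n)"
proof -
  note A = assms(1) and C = assms(2) and Y = assms(5)
  let ?G = "gram_rows n (\<lambda>r i. obs_mat A C N $$ (r, i))"
  let ?T = "obs_row_set C N Y"
  define w where "w = det (?G ?T)"
  define W where "W = det (?G {0..<N * p})"
  note gram = sensor_gramian_eq_gram_rows[OF A C]
  have T: "?T \<subseteq> {0..<N * p}" by (rule obs_row_set_subset[OF A C Y])
  have fin: "finite ?T" using T by (rule finite_subset) simp
  have "w \<noteq> 0"
    using det_pd_mat_nonzero[OF assms(6)[unfolded gram[OF Y]] gram_rows_carrier] by (simp add: w_def)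
  \<comment> \<open>Positive definiteness has only been used to exclude zero; the sign comes from
    the sum of squares.\<close>
  then have w: "0 < w"
    using det_gram_rows_nonneg[OF fin] by (simp add: w_def order_less_le)
  \<comment> \<open>By monotonicity \<open>W\<close> is at least \<open>w\<close>, so the
    normalising constant of the DPP is positive.\<close>
  have W: "0 < W"
    using w det_gram_rows_mono[OF _ T] by (force simp: w_def W_def intro: less_le_trans)
  have prob: "measure_pmf.prob (kdpp L n) {Y'. Y' \<subseteq> ?T} = w / W"
    unfolding L_def w_def W_def
    by (rule prob_kdpp_subset[OF obs_mat_carrier[OF A C] T]) (use W in \<open>simp add: W_def\<close>)
  have gram_Y: "det (sensor_gramian A C N Y) = w"
    by (simp add: w_def gram[OF Y])
  have gram_all: "det (sensor_gramian A C N {0..<p}) = W"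
    by (simp add: W_def gram obs_row_set_all[OF A C])
  have cov_Y: "det (error_cov A C N \<sigma> Y) = (\<sigma>\<^sup>2) ^ n / w"
    using det_error_cov[OF A C Y] w by (simp add: gram_Y)
  have cov_all: "det (error_cov A C N \<sigma> {0..<p}) = (\<sigma>\<^sup>2) ^ n / W"
    using det_error_cov[OF A C subset_refl] W by (simp add: gram_all)
  \<comment> \<open>The left side is the determinant of the scaled full Gramian, itself a Gram
    matrix, so Loewner monotonicity applies.\<close>
  have bound: "(1 - \<epsilon>) ^ n * W \<le> w"
    if "\<epsilon> < 1" "loewner_le ((1 - \<epsilon>) \<cdot>\<^sub>m obs_gramian A C N) (sensor_gramian A C N Y)" for \<epsilon>
  proof -
    have "(1 - \<epsilon>) \<cdot>\<^sub>m obs_gramian A C N =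
        gram_rows n (\<lambda>r i. sqrt (1 - \<epsilon>) * obs_mat A C N $$ (r, i)) {..<N * p}"
      using that(1) by (simp add: obs_gramian_eq_gram_rows[OF A C] smult_gram_rows atLeast0LessThan)
    then have "det ((1 - \<epsilon>) \<cdot>\<^sub>m obs_gramian A C N) \<le> det (sensor_gramian A C N Y)"
      using det_gram_rows_le_loewner that(2) gram[OF Y] by (metis gram_rows_carrier)
    then show ?thesis
      by (simp add: gram_Y W_def obs_gramian_eq_gram_rows[OF A C] gram_rows_def)
  qed
  have s: "0 < (\<sigma>\<^sup>2) ^ n" using assms(4) by simp
  show ?thesis
  proof (intro conjI allI impI)
    show "measure_pmf.prob (kdpp L n) {Y'. Y' \<subseteq> ?T} =
        det (error_cov A C N \<sigma> {0..<p}) / det (error_cov A C N \<sigma> Y)"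
      using assms(4) w W by (simp add: prob cov_Y cov_all)
  next
    fix \<epsilon> :: real
    assume e: "0 \<le> \<epsilon> \<and> \<epsilon> < 1
      \<and> loewner_le ((1 - \<epsilon>) \<cdot>\<^sub>m obs_gramian A C N) (sensor_gramian A C N Y)"
    then have le: "(1 - \<epsilon>) ^ n * W \<le> w" and pos: "0 < (1 - \<epsilon>) ^ n"
      using bound[of \<epsilon>] by simp_all
    show "measure_pmf.prob (kdpp L n) {Y'. Y' \<subseteq> ?T} \<ge> (1 - \<epsilon>) ^ n"
      using le W by (simp add: prob pos_le_divide_eq)
    have "(\<sigma>\<^sup>2) ^ n / w \<le> (\<sigma>\<^sup>2) ^ n / ((1 - \<epsilon>) ^ n * W)"
      by (rule divide_left_mono[OF le less_imp_le[OF s]]) (intro mult_pos_pos w pos W)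
    then show "det (error_cov A C N \<sigma> Y) \<le> det (error_cov A C N \<sigma> {0..<p}) / (1 - \<epsilon>) ^ n"
      by (simp add: cov_Y cov_all mult.commute)
  qed
qed

end
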